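(* For every $n\in\mathbb N=\{1,2,\dots\}$, $$q(n,x)=\prod_{1<d\mid(2n+1)}C(d,x),$$ the product being over all divisors $d>1$ of $2n+1$.
   Context: $C(n,x)$ is the minimal polynomial over $\mathbb Q$ of $2\cos(\pi/n)$. $S(k,x)=U_k(x/2)$, where $U_k$ is the Chebyshev polynomial of the second kind. For $n\ge 0$ the $q$-polynomials are defined by $q(n,x)=\dfrac{S(2n,x)}{S(2n,\sqrt{2+x})}$ (since $S(2n,y)$ is an even polynomial in $y$, the denominator is a polynomial in $x$); this quotient is a monic integer polynomial of degree $n$ in $x$. *)

theory Defs
  imports Complex_Main "HOL-Computational_Algebra.Computational_Algebra"
begin

definition rat_poly_eval :: "rat poly \<Rightarrow> 'a::field_char_0 \<Rightarrow> 'a" where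
  "rat_poly_eval p a = poly (map_poly of_rat p) a"

text \<open>
  The monic rational polynomial of least degree vanishing at \<open>a\<close>. It is only meaningful for
  algebraic \<open>a\<close>; see \<open>min_poly_rat\<close> below for existence and uniqueness.
\<close>

definition is_min_poly_rat :: "rat poly \<Rightarrow> 'a::field_char_0 \<Rightarrow> bool" where
  "is_min_poly_rat p a \<longleftrightarrow>
     lead_coeff p = 1 \<and> rat_poly_eval p a = 0 \<and>
     (\<forall>r. r \<noteq> 0 \<and> rat_poly_eval r a = 0 \<longrightarrow> degree p \<le> degree r)"

definition min_poly_rat :: "'a::field_char_0 \<Rightarrow> rat poly" where
  "min_poly_rat a = (THE p. is_min_poly_rat p a)"

definition C_poly :: "nat \<Rightarrow> rat poly" where
  "C_poly n = min_poly_rat (2 * cos (pi / real n))"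

fun chebyshev_U :: "nat \<Rightarrow> rat poly" where
  "chebyshev_U 0 = 1"
| "chebyshev_U (Suc 0) = [:0, 2:]"
| "chebyshev_U (Suc (Suc k)) = [:0, 2:] * chebyshev_U (Suc k) - chebyshev_U k"

definition S_poly :: "nat \<Rightarrow> rat poly" where
  "S_poly k = pcompose (chebyshev_U k) [:0, 1/2:]"

text \<open>
  \<open>S(2n, sqrt (2 + x))\<close> as a polynomial in \<open>x\<close>: the unique polynomial agreeing with it
  wherever the real square root makes sense (see \<open>q_denom\<close>, \<open>q_denom_unique\<close> below).
\<close>

definition q_denom :: "nat \<Rightarrow> rat poly" where
  "q_denom n = (THE D. \<forall>x::real. x \<ge> -2 \<longrightarrow>
      rat_poly_eval D x = rat_poly_eval (S_poly (2 * n)) (sqrt (2 + x)))"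

text \<open>The division is exact: see \<open>q_denom_times_q_poly\<close>.\<close>

definition q_poly :: "nat \<Rightarrow> rat poly" where
  "q_poly n = S_poly (2 * n) div q_denom n"


subsection \<open>Well-definedness\<close>

lemma rat_poly_eval_simps [simp]:
  "rat_poly_eval 0 a = 0" "rat_poly_eval 1 a = 1"
  "rat_poly_eval (pCons c p) a = of_rat c + a * rat_poly_eval p a"
  by (auto simp: rat_poly_eval_def map_poly_pCons map_poly_1)

lemma rat_poly_eval_add [simp]:
  "rat_poly_eval (p + r) a = rat_poly_eval p a + rat_poly_eval r a"
  unfolding rat_poly_eval_def
  by (induction p r rule: poly_induct2) (auto simp: map_poly_pCons of_rat_add algebra_simps)

lemma rat_poly_eval_smult [simp]:
  "rat_poly_eval (smult c p) a = of_rat c * rat_poly_eval p a"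
  by (induction p) (auto simp: of_rat_mult algebra_simps)

lemma rat_poly_eval_diff [simp]:
  "rat_poly_eval (p - r) a = rat_poly_eval p a - rat_poly_eval r a"
  using rat_poly_eval_add[of "p - r" r a] by (simp add: algebra_simps)

lemma rat_poly_eval_mult [simp]:
  "rat_poly_eval (p * r) a = rat_poly_eval p a * rat_poly_eval r a"
  by (induction p) (auto simp: algebra_simps)

lemma rat_poly_eval_pcompose [simp]:
  "rat_poly_eval (pcompose p r) a = rat_poly_eval p (rat_poly_eval r a)"
  by (induction p) (auto simp: pcompose_pCons)

lemma is_min_poly_rat_unique:
  assumes "is_min_poly_rat p a" "is_min_poly_rat r a"
  shows "p = r"
proof (rule ccontr)
  assume "p \<noteq> r"
  have deg: "degree p = degree r"
    using assms unfolding is_min_poly_rat_def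
    by (metis le_antisym leading_coeff_0_iff zero_neq_one)
  have 0: "p - r \<noteq> 0" using \<open>p \<noteq> r\<close> by simp
  have "degree p \<noteq> 0"
  proof
    assume "degree p = 0"
    then have "p = 1" "r = 1"
      using assms deg unfolding is_min_poly_rat_def
      by (metis degree_eq_zeroE lead_coeff_pCons(2) one_pCons)+
    with \<open>p \<noteq> r\<close> show False by simp
  qed
  moreover have "coeff (p - r) (degree p) = 0"
    using assms deg by (simp add: is_min_poly_rat_def)
  moreover have "degree (p - r) \<le> degree p"
    using degree_diff_le_max[of p r] deg by simp
  ultimately have "degree (p - r) < degree p"
    using 0 by (metis le_neq_implies_less leading_coeff_0_iff)
  moreover have "rat_poly_eval (p - r) a = 0"
    using assms by (simp add: is_min_poly_rat_def)
  moreover from this 0 have "degree p \<le> degree (p - r)"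
    using assms(1) unfolding is_min_poly_rat_def by blast
  ultimately show False by linarith
qed

lemma min_poly_rat:
  assumes "r \<noteq> 0" "rat_poly_eval r a = 0"
  shows "is_min_poly_rat (min_poly_rat a) a"
proof -
  define P where "P = (\<lambda>p. p \<noteq> 0 \<and> rat_poly_eval p a = 0)"
  define p where "p = arg_min degree P"
  have "P r" using assms by (simp add: P_def)
  then have p: "P p" "\<And>s. P s \<Longrightarrow> degree p \<le> degree s"
    unfolding p_def by (blast intro: arg_min_natI, blast intro: arg_min_nat_le)
  have "is_min_poly_rat (smult (inverse (lead_coeff p)) p) a"
    using p by (auto simp: is_min_poly_rat_def P_def)
  then show ?thesis
    unfolding min_poly_rat_def by (metis theI is_min_poly_rat_unique)
qed

lemma S_poly_simps [simp]:
  "S_poly 0 = 1" "S_poly (Suc 0) = [:0, 1:]"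
  "S_poly (Suc (Suc k)) = [:0, 1:] * S_poly (Suc k) - S_poly k"
proof -
  show "S_poly 0 = 1" "S_poly (Suc 0) = [:0, 1:]"
    by (auto simp: S_poly_def pcompose_1 pcompose_pCons)
  have "pcompose [:0, 2:] [:0, 1/2:] = [:0, 1:: rat:]" by (simp add: pcompose_pCons)
  then show "S_poly (Suc (Suc k)) = [:0, 1:] * S_poly (Suc k) - S_poly k"
    unfolding S_poly_def chebyshev_U.simps pcompose_diff pcompose_mult by presburger
qed

lemma lead_coeff_S_poly: "degree (S_poly k) = k \<and> lead_coeff (S_poly k) = 1"
proof (induction k rule: induct_nat_012)
  case (ge2 k)
  have eq: "S_poly (Suc (Suc k)) = pCons 0 (S_poly (Suc k)) - S_poly k" by simp
  have ne: "S_poly (Suc k) \<noteq> 0" using ge2(2) by auto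
  have d: "degree (S_poly k) < degree (pCons 0 (S_poly (Suc k)))" using ge2 ne by simp
  have "degree (S_poly (Suc (Suc k))) = degree (pCons 0 (S_poly (Suc k)))"
    unfolding eq diff_conv_add_uminus by (rule degree_add_eq_left) (use d in simp)
  then have deg: "degree (S_poly (Suc (Suc k))) = Suc (Suc k)" using ge2 ne by simp
  moreover have "coeff (S_poly (Suc (Suc k))) (Suc (Suc k)) = 1"
  proof -
    have "coeff (S_poly (Suc k)) (Suc k) = 1" using ge2(2) by metis
    moreover have "coeff (S_poly k) (Suc (Suc k)) = 0"
      using ge2(1) by (intro coeff_eq_0) linarith
    ultimately show ?thesis unfolding eq coeff_diff coeff_pCons_Suc by simp
  qed
  ultimately show ?case by simp
qed auto

lemma S_poly_eval_cos:
  "rat_poly_eval (S_poly k) (2 * cos t) * sin t = sin (real (Suc k) * t)"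
proof (induction k rule: induct_nat_012)
  case (ge2 k)
  define u where "u = real (Suc (Suc k)) * t"
  have 1: "real (Suc (Suc (Suc k))) * t = u + t" "real (Suc k) * t = u - t"
    by (simp_all add: u_def algebra_simps)
  have "rat_poly_eval (S_poly (Suc (Suc k))) (2 * cos t) * sin t =
      2 * cos t * (rat_poly_eval (S_poly (Suc k)) (2 * cos t) * sin t) -
      rat_poly_eval (S_poly k) (2 * cos t) * sin t"
    unfolding S_poly_simps(3) rat_poly_eval_diff rat_poly_eval_mult by (simp add: left_diff_distrib)
  also have "\<dots> = 2 * cos t * sin u - sin (u - t)"
    unfolding ge2 1 u_def ..
  also have "\<dots> = sin (u + t)"
    unfolding sin_add sin_diff by algebra
  finally show ?case unfolding 1 .
qed (auto simp: sin_double)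

lemma C_poly:
  assumes "n \<ge> 1"
  shows "is_min_poly_rat (C_poly n) (2 * cos (pi / real n))"
proof (cases "n = 1")
  case True
  show ?thesis unfolding C_poly_def
    by (rule min_poly_rat[of "[:2, 1:]"]) (use True in auto)
next
  case False
  with assms have n: "n \<ge> 2" by simp
  then have "sin (pi / real n) > 0" by (intro sin_gt_zero) (auto simp: field_simps)
  moreover have "rat_poly_eval (S_poly (n - 1)) (2 * cos (pi / real n)) * sin (pi / real n) = 0"
    unfolding S_poly_eval_cos using n by simp
  moreover have "S_poly (n - 1) \<noteq> 0"
    using lead_coeff_S_poly[of "n - 1"] by auto
  ultimately show ?thesis unfolding C_poly_def
    by (intro min_poly_rat[of "S_poly (n - 1)"]) auto
qed

lemma q_denom_unique:
  fixes D E :: "rat poly"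
  assumes "\<And>x::real. x \<ge> -2 \<Longrightarrow> rat_poly_eval D x = rat_poly_eval E x"
  shows "D = E"
proof (rule ccontr)
  assume "D \<noteq> E"
  then have "map_poly (of_rat :: rat \<Rightarrow> real) (D - E) \<noteq> 0"
    by (subst map_poly_eq_0_iff) auto
  then have "finite {x::real. rat_poly_eval (D - E) x = 0}"
    unfolding rat_poly_eval_def by (rule poly_roots_finite)
  moreover have "{-2::real..} \<subseteq> {x::real. rat_poly_eval (D - E) x = 0}"
    using assms by auto
  ultimately show False using infinite_Ici finite_subset by blast
qed

lemma S_poly_comp_square:
  "pcompose (S_poly (Suc n)) [:-2, 0, 1:] + pcompose (S_poly n) [:-2, 0, 1:] =
     S_poly (2 * Suc n)"
proof (induction n rule: induct_nat_012)
  case (ge2 n)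
  define w where "w = [:-2, 0, 1::rat:]"
  have w: "w = [:0, 1:] * [:0, 1:] - 2" by (simp add: w_def numeral_poly)
  have comp: "pcompose (S_poly (Suc (Suc k))) w =
      w * pcompose (S_poly (Suc k)) w - pcompose (S_poly k) w" for k
    by (simp only: S_poly_simps pcompose_diff pcompose_mult) (simp add: pcompose_pCons)
  have S: "S_poly (k + 4) = w * S_poly (k + 2) - S_poly k" for k
  proof -
    have eqs: "k + 4 = Suc (Suc (Suc (Suc k)))" "k + 2 = Suc (Suc k)" by simp_all
    have "S_poly (Suc (Suc (Suc (Suc k)))) = [:0, 1:] * S_poly (Suc (Suc (Suc k))) - S_poly (Suc (Suc k))"
      "S_poly (Suc (Suc (Suc k))) = [:0, 1:] * S_poly (Suc (Suc k)) - S_poly (Suc k)"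
      "S_poly (Suc (Suc k)) = [:0, 1:] * S_poly (Suc k) - S_poly k"
      by (rule S_poly_simps(3))+
    then show ?thesis unfolding w eqs by algebra
  qed
  have "pcompose (S_poly (Suc (Suc (Suc n)))) w + pcompose (S_poly (Suc (Suc n))) w =
      w * (pcompose (S_poly (Suc (Suc n))) w + pcompose (S_poly (Suc n)) w)
      - (pcompose (S_poly (Suc n)) w + pcompose (S_poly n) w)"
    unfolding comp[of "Suc n"] comp[of n] by algebra
  also have "\<dots> = w * S_poly (2 * Suc (Suc n)) - S_poly (2 * Suc n)"
    using ge2 unfolding w_def by presburger
  also have "\<dots> = S_poly (2 * Suc (Suc (Suc n)))"
  proof -
    have "2 * Suc (Suc (Suc n)) = 2 * Suc n + 4" "2 * Suc (Suc n) = 2 * Suc n + 2" by simp_all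
    then show ?thesis using S[of "2 * Suc n"] by metis
  qed
  finally show ?case unfolding w_def .
qed (auto simp: pcompose_1 pcompose_pCons eval_nat_numeral one_pCons)

lemma q_denom_eqs:
  "q_denom 0 = 1" "q_denom (Suc n) = S_poly (Suc n) + S_poly n"
proof -
  have 0: "q_denom n = D"
    if "\<And>x::real. x \<ge> -2 \<Longrightarrow> rat_poly_eval D x = rat_poly_eval (S_poly (2 * n)) (sqrt (2 + x))"
    for n D
    unfolding q_denom_def by (rule the_equality) (use that in \<open>auto intro: q_denom_unique\<close>)
  show "q_denom 0 = 1" by (rule 0) simp
  show "q_denom (Suc n) = S_poly (Suc n) + S_poly n"
  proof (rule 0)
    fix x :: real assume "x \<ge> -2"
    then show "rat_poly_eval (S_poly (Suc n) + S_poly n) x =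
        rat_poly_eval (S_poly (2 * Suc n)) (sqrt (2 + x))"
      unfolding S_poly_comp_square[symmetric] by (simp del: S_poly_simps)
  qed
qed

lemma q_denom:
  assumes "x \<ge> -2"
  shows "rat_poly_eval (q_denom n) x = rat_poly_eval (S_poly (2 * n)) (sqrt (2 + x))"
proof (cases n)
  case (Suc m)
  with assms show ?thesis
    unfolding Suc q_denom_eqs S_poly_comp_square[symmetric] by (simp del: S_poly_simps)
qed (simp add: q_denom_eqs)

lemma S_poly_add:
  "S_poly (m + n + 2) = S_poly (m + 1) * S_poly (n + 1) - S_poly m * S_poly n"
proof (induction n rule: induct_nat_012)
  case (ge2 n)
  have "S_poly (m + Suc (Suc n) + 2) = [:0, 1:] * S_poly (m + Suc n + 2) - S_poly (m + n + 2)"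
    using S_poly_simps(3)[of "m + n + 2"] by (simp del: S_poly_simps)
  also have "\<dots> = S_poly (m + 1) * ([:0, 1:] * S_poly (Suc (Suc n)) - S_poly (Suc n))
      - S_poly m * ([:0, 1:] * S_poly (Suc n) - S_poly n)"
    using ge2 unfolding Suc_eq_plus1 by algebra
  also have "\<dots> = S_poly (m + 1) * S_poly (Suc (Suc n) + 1) - S_poly m * S_poly (Suc (Suc n))"
    unfolding Suc_eq_plus1[symmetric] S_poly_simps(3)[symmetric] ..
  finally show ?case .
qed (auto simp: algebra_simps)

lemma q_poly_eqs:
  "q_poly 0 = 1" "q_poly (Suc n) = S_poly (Suc n) - S_poly n"
proof -
  show "q_poly 0 = 1" by (simp add: q_poly_def q_denom_eqs)
  have ne: "S_poly (Suc n) + S_poly n \<noteq> 0"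
    using lead_coeff_S_poly[of n] lead_coeff_S_poly[of "Suc n"]
    by (metis add_eq_0_iff degree_minus n_not_Suc_n)
  have "2 * Suc n = n + n + 2" by simp
  then have "S_poly (2 * Suc n) = S_poly (n + n + 2)" by (simp only:)
  also have "\<dots> = (S_poly (Suc n) + S_poly n) * (S_poly (Suc n) - S_poly n)"
    unfolding S_poly_add Suc_eq_plus1 by algebra
  finally show "q_poly (Suc n) = S_poly (Suc n) - S_poly n"
    unfolding q_poly_def q_denom_eqs using ne by (simp del: S_poly_simps)
qed

lemma q_denom_times_q_poly: "q_denom n * q_poly n = S_poly (2 * n)"
proof (cases n)
  case (Suc m)
  have eq: "2 * Suc m = m + m + 2" by simp
  show ?thesis
    unfolding Suc q_denom_eqs q_poly_eqs eq S_poly_add unfolding Suc_eq_plus1 by algebra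
qed (simp add: q_denom_eqs q_poly_eqs)

end

(*
  Idea. The roots of q(n,x) are 2 cos (m pi / (2n+1)) for odd m < 2n+1, so the claim amounts to
  showing that every 2 cos (m pi / d) with m odd and coprime to d is a conjugate of 2 cos (pi / d).
  As for cyclotomic polynomials, it suffices to see that the conjugacy class of a root a = 2 cos t
  of q(n,x) is closed under t -> p t for odd primes p not dividing N = 2n+1. Put b = 2 cos (p t) and
  write q = f s with f the minimal polynomial of a; by Gauss's lemma f and s are integral. In Z[a]
  we have b == a^p and hence f(b) == f(a)^p = 0 modulo p. If f(b) were not 0, then s(b) = 0
  and q'(b) = f(b) s'(b) == 0 modulo p. But differentiating q(2 cos t) cos(t/2) = cos(N t/2) at a
  root gives q'(b)^2 (4 - b^2) (2 + b) = N^2, so p would divide N.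
*)
theory Submission
  imports Defs
begin

subsection \<open>Integer polynomials and Gauss's lemma\<close>

abbreviation rat_of_int_poly :: "int poly \<Rightarrow> rat poly" where
  "rat_of_int_poly \<equiv> map_poly of_int"

lemma rat_of_int_poly_pCons [simp]:
  "rat_of_int_poly (pCons c h) = pCons (of_int c) (rat_of_int_poly h)"
  by (simp add: map_poly_pCons)

lemma coeff_rat_of_int_poly [simp]: "coeff (rat_of_int_poly h) i = of_int (coeff h i)"
  by (simp add: coeff_map_poly)

lemma degree_rat_of_int_poly [simp]: "degree (rat_of_int_poly h) = degree h"
  by (rule degree_map_poly) auto

lemma rat_of_int_poly_add: "rat_of_int_poly (g + h) = rat_of_int_poly g + rat_of_int_poly h"
  and rat_of_int_poly_diff: "rat_of_int_poly (g - h) = rat_of_int_poly g - rat_of_int_poly h"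
  and rat_of_int_poly_smult: "rat_of_int_poly (smult c h) = smult (of_int c) (rat_of_int_poly h)"
  by (rule poly_eqI; simp)+

lemma rat_of_int_poly_mult: "rat_of_int_poly (g * h) = rat_of_int_poly g * rat_of_int_poly h"
  by (induction g) (auto simp: rat_of_int_poly_add rat_of_int_poly_smult)

lemma rat_of_int_poly_inject [simp]: "rat_of_int_poly g = rat_of_int_poly h \<longleftrightarrow> g = h"
  by (metis coeff_rat_of_int_poly of_int_eq_iff poly_eqI)

lemma pderiv_rat_of_int_poly: "pderiv (rat_of_int_poly h) = rat_of_int_poly (pderiv h)"
  by (rule poly_eqI) (simp add: coeff_pderiv)

lemma rat_poly_clear_denominators:
  obtains k :: int and h where "k \<noteq> 0" "smult (of_int k) p = rat_of_int_poly h"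
proof -
  have "\<exists>k h. k \<noteq> 0 \<and> smult (of_int k) p = rat_of_int_poly h"
  proof (induction p)
    case 0
    show ?case by (rule exI[of _ 1], rule exI[of _ 0]) simp
  next
    case (pCons a p)
    then obtain k h where k: "k \<noteq> 0" "smult (of_int k) p = rat_of_int_poly h" by blast
    obtain x y where a: "a = of_int x / of_int y" "y \<noteq> 0"
      by (metis quotient_of_div surj_pair quotient_of_denom_pos less_irrefl)
    have "smult (of_int (y * k)) (pCons a p) = rat_of_int_poly (pCons (x * k) (smult y h))"
      using a k(2)[symmetric] by (simp add: rat_of_int_poly_smult)
    moreover have "y * k \<noteq> 0" using a k by simp
    ultimately show ?case by blast
  qed
  with that show ?thesis by blast
qed

text \<open>Clear denominators, then divide by the content. Comparing leading coefficients on both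
  sides identifies the remaining scalar as the leading coefficient of \<open>h\<close>, because
  \<open>p\<close> is monic.\<close>

lemma monic_rat_poly_primitive:
  assumes "lead_coeff p = 1"
  obtains h where "content h = 1" "rat_of_int_poly h = smult (of_int (lead_coeff h)) p"
proof -
  obtain k g where k: "k \<noteq> 0" "smult (of_int k) p = rat_of_int_poly g"
    by (rule rat_poly_clear_denominators)
  define h where "h = primitive_part g"
  have g: "g = smult (content g) h" by (simp add: h_def)
  have "g \<noteq> 0" using k assms by auto
  then have c: "content g \<noteq> 0" and "content h = 1" by (simp_all add: h_def)
  have kp: "smult (of_int k) p = smult (of_int (content g)) (rat_of_int_poly h)"
    by (subst k(2), subst g) (rule rat_of_int_poly_smult)
  then have "degree p = degree h"
    using k c by (metis degree_rat_of_int_poly degree_smult_eq of_int_eq_0_iff)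
  then have "(of_int k :: rat) = of_int (content g) * of_int (lead_coeff h)"
    using arg_cong[OF kp, of "\<lambda>s. coeff s (degree p)"] assms by simp
  with kp have "smult (of_int (content g)) (rat_of_int_poly h) =
      smult (of_int (content g)) (smult (of_int (lead_coeff h)) p)" by simp
  then have "rat_of_int_poly h = smult (of_int (lead_coeff h)) p"
    using c by (metis of_int_eq_0_iff smult_cancel)
  with \<open>content h = 1\<close> that show ?thesis by blast
qed

text \<open>Gauss's lemma: the primitive multiples \<open>P\<close> and \<open>S\<close> have a
  primitive product. That product is also \<open>lead_coeff P * lead_coeff S\<close> times the
  integral \<open>Q\<close>, so this scalar must be a unit of the integers.\<close>

lemma monic_rat_factors_integral:
  assumes "lead_coeff p = 1" "lead_coeff s = 1" "p * s = rat_of_int_poly Q"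
  obtains P S where "p = rat_of_int_poly P" "s = rat_of_int_poly S"
proof -
  obtain P where P: "content P = 1" "rat_of_int_poly P = smult (of_int (lead_coeff P)) p"
    using assms(1) by (rule monic_rat_poly_primitive)
  obtain S where S: "content S = 1" "rat_of_int_poly S = smult (of_int (lead_coeff S)) s"
    using assms(2) by (rule monic_rat_poly_primitive)
  have "rat_of_int_poly (P * S) = rat_of_int_poly (smult (lead_coeff P * lead_coeff S) Q)"
    by (subst rat_of_int_poly_mult, subst P(2), subst S(2))
       (simp add: rat_of_int_poly_smult assms(3) mult.commute)
  then have eq: "P * S = smult (lead_coeff P * lead_coeff S) Q" by (simp only: rat_of_int_poly_inject)
  have "content (P * S) = 1" using P S by (simp add: content_mult)
  then have "normalize (lead_coeff P * lead_coeff S) * content Q = 1"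
    unfolding eq by simp
  then have "is_unit (lead_coeff P * lead_coeff S)"
    by (metis dvd_triv_left normalize_dvd_iff)
  then have "is_unit (lead_coeff P)" "is_unit (lead_coeff S)"
    by (simp_all only: is_unit_mult_iff)
  then have u: "lead_coeff P = 1 \<or> lead_coeff P = -1" "lead_coeff S = 1 \<or> lead_coeff S = -1"
    by (simp_all add: abs_if split: if_splits)
  \<comment> \<open>A leading coefficient 1 or -1 is its own inverse, so multiplying by it recovers
    the monic polynomial.\<close>
  have "p = rat_of_int_poly (smult (lead_coeff P) P)" "s = rat_of_int_poly (smult (lead_coeff S) S)"
    using u P(2) S(2) by (auto simp: rat_of_int_poly_smult)
  with that show ?thesis by blast
qed

subsection \<open>Minimal polynomials\<close>

lemma min_poly_rat_dvd:
  assumes "is_min_poly_rat f a" "rat_poly_eval r a = 0"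
  shows "f dvd r"
proof (rule ccontr)
  assume "\<not> f dvd r"
  then have ne: "r mod f \<noteq> 0" by (simp add: dvd_eq_mod_eq_0)
  have "f \<noteq> 0" using assms by (auto simp: is_min_poly_rat_def)
  have "rat_poly_eval (r div f * f + r mod f) a = 0" using assms(2) by simp
  then have "rat_poly_eval (r mod f) a = 0"
    using assms(1) unfolding rat_poly_eval_add rat_poly_eval_mult by (simp add: is_min_poly_rat_def)
  with assms(1) ne have "degree f \<le> degree (r mod f)" by (simp add: is_min_poly_rat_def)
  moreover have "degree (r mod f) < degree f"
    using ne \<open>f \<noteq> 0\<close> degree_mod_less' by blast
  ultimately show False by simp
qed

lemma min_poly_rat_degree_pos:
  assumes "is_min_poly_rat f a"
  shows "degree f > 0"
proof (rule ccontr)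
  assume "\<not> degree f > 0"
  then obtain c where "f = [:c:]" by (metis degree_eq_zeroE neq0_conv)
  with assms show False by (auto simp: is_min_poly_rat_def)
qed

text \<open>Irreducibility in disguise: write \<open>f = g * h\<close> with \<open>g\<close> the
  minimal polynomial of \<open>b\<close>. The cofactor \<open>h\<close> has too small a degree to
  vanish at \<open>a\<close>, so \<open>g\<close> does, and minimality at \<open>a\<close> forces
  \<open>g\<close> to have at least the degree of \<open>f\<close>.\<close>

lemma min_poly_rat_conjugate:
  assumes f: "is_min_poly_rat f a" and b: "rat_poly_eval f b = 0"
  shows "is_min_poly_rat f b"
proof -
  have "f \<noteq> 0" using f by (auto simp: is_min_poly_rat_def)
  define g where "g = min_poly_rat b"
  have g: "is_min_poly_rat g b"
    unfolding g_def using \<open>f \<noteq> 0\<close> b by (rule min_poly_rat)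
  then obtain h where h: "f = g * h" using min_poly_rat_dvd[OF g b] by blast
  then have ne: "g \<noteq> 0" "h \<noteq> 0" using \<open>f \<noteq> 0\<close> by auto
  then have "degree h < degree f"
    unfolding h using min_poly_rat_degree_pos[OF g] by (simp add: degree_mult_eq)
  then have "rat_poly_eval h a \<noteq> 0"
    using f ne(2) by (auto simp: is_min_poly_rat_def not_le[symmetric])
  then have "rat_poly_eval g a = 0" using f h by (simp add: is_min_poly_rat_def)
  then have "degree f \<le> degree g" using f ne(1) by (simp add: is_min_poly_rat_def)
  with f g b show ?thesis unfolding is_min_poly_rat_def by (meson order_trans)
qed

text \<open>Non-vanishing at the other points takes the place of coprimality: the product collected
  so far is nonzero at the new point, so its cofactor in \<open>q\<close> vanishes there and absorbs
  the next minimal polynomial.\<close>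

lemma prod_min_poly_rat_dvd:
  assumes "finite A" "\<And>i. i \<in> A \<Longrightarrow> is_min_poly_rat (f i) (a i)"
    and "\<And>i. i \<in> A \<Longrightarrow> rat_poly_eval q (a i) = 0"
    and "\<And>i j. i \<in> A \<Longrightarrow> j \<in> A \<Longrightarrow> i \<noteq> j \<Longrightarrow> rat_poly_eval (f i) (a j) \<noteq> 0"
  shows "prod f A dvd q"
  using assms
proof (induction A)
  case (insert i A)
  then obtain s where s: "q = prod f A * s" by (auto elim!: dvdE)
  have nz: "\<And>j. j \<in> A \<Longrightarrow> j \<noteq> i \<Longrightarrow> rat_poly_eval (f j) (a i) \<noteq> 0"
    using insert.prems(3) by simp
  have "rat_poly_eval (prod f B) (a i) \<noteq> 0" if "finite B" "B \<subseteq> A" for B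
    using that
  proof (induction B)
    case (insert j B)
    then have "j \<in> A" "j \<noteq> i" using \<open>i \<notin> A\<close> by auto
    then have "rat_poly_eval (f j) (a i) \<noteq> 0" using nz by simp
    with insert show ?case by simp
  qed simp
  then have "rat_poly_eval (prod f A) (a i) \<noteq> 0" using insert(1) by blast
  then have "rat_poly_eval s (a i) = 0" using insert.prems(2)[of i] s by simp
  then have "f i dvd s" using insert.prems(1) by (intro min_poly_rat_dvd) auto
  then show ?case using s insert(1,2) by (simp add: mult.commute mult_dvd_mono)
qed auto

subsection \<open>Roots and derivative of \<open>q_poly\<close>\<close>

lemma q_poly_rec: "q_poly (Suc (Suc n)) = [:0, 1:] * q_poly (Suc n) - q_poly n"
proof (cases n)
  case (Suc m)
  show ?thesis unfolding Suc q_poly_eqs(2) S_poly_simps(3)[of m] S_poly_simps(3)[of "Suc m"]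
    by algebra
qed (simp add: q_poly_eqs one_pCons)

text \<open>Both sides obey the recurrence cos (u + t) = 2 cos t cos u - cos (u - t). Keeping cos (t
  / 2) as a factor instead of dividing by it makes the identity valid for every \<open>t\<close>,
  hence differentiable in \<open>t\<close>.\<close>

lemma q_poly_eval_cos:
  "rat_poly_eval (q_poly n) (2 * cos t) * cos (t / 2) = cos (real (2 * n + 1) * t / 2)"
proof (induction n rule: induct_nat_012)
  case 1
  define u where "u = t / 2"
  have t: "t = 2 * u" by (simp add: u_def)
  have "cos (3 * u) = 4 * cos u ^ 3 - 3 * cos u" by (rule cos_treble_cos)
  then show ?case unfolding t cos_double_cos
    by (simp add: q_poly_eqs power2_eq_square power3_eq_cube algebra_simps)
next
  case (ge2 n)
  define u where "u = real (2 * Suc n + 1) * t / 2"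
  have 1: "real (2 * Suc (Suc n) + 1) * t / 2 = u + t" "real (2 * n + 1) * t / 2 = u - t"
    by (simp_all add: u_def field_simps)
  have "rat_poly_eval (q_poly (Suc (Suc n))) (2 * cos t) * cos (t / 2) =
      2 * cos t * (rat_poly_eval (q_poly (Suc n)) (2 * cos t) * cos (t / 2)) -
      rat_poly_eval (q_poly n) (2 * cos t) * cos (t / 2)"
    unfolding q_poly_rec by (simp add: left_diff_distrib)
  also have "\<dots> = 2 * cos t * cos u - cos (u - t)"
    unfolding ge2 1 u_def ..
  also have "\<dots> = cos (u + t)"
    unfolding cos_add cos_diff by algebra
  finally show ?case unfolding 1 .
qed (simp add: q_poly_eqs)

lemma lead_coeff_q_poly: "degree (q_poly n) = n \<and> lead_coeff (q_poly n) = 1"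
proof (cases n)
  case (Suc m)
  have d: "degree (S_poly m) < degree (S_poly (Suc m))"
    using lead_coeff_S_poly[of m] lead_coeff_S_poly[of "Suc m"] by simp
  have "degree (q_poly n) = n"
    unfolding Suc q_poly_eqs(2) diff_conv_add_uminus
    by (subst degree_add_eq_left) (use d lead_coeff_S_poly in simp_all)
  moreover have "coeff (q_poly n) n = 1"
    using lead_coeff_S_poly[of m] lead_coeff_S_poly[of "Suc m"] coeff_eq_0[of "S_poly m" "Suc m"]
    unfolding Suc q_poly_eqs(2) coeff_diff by (metis diff_zero lessI)
  ultimately show ?thesis by simp
qed (simp add: q_poly_eqs)

lemma q_poly_integral: "\<exists>Q. q_poly n = rat_of_int_poly Q"
proof (induction n rule: induct_nat_012)
  case 0
  show ?case by (rule exI[of _ 1]) (simp add: q_poly_eqs one_pCons)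
next
  case 1
  show ?case by (rule exI[of _ "[:-1, 1:]"]) (simp add: q_poly_eqs one_pCons)
next
  case (ge2 n)
  then obtain P Q where "q_poly n = rat_of_int_poly P" "q_poly (Suc n) = rat_of_int_poly Q" by blast
  then have "q_poly (Suc (Suc n)) = rat_of_int_poly ([:0, 1:] * Q - P)"
    unfolding q_poly_rec rat_of_int_poly_diff rat_of_int_poly_mult by simp
  then show ?case by blast
qed

lemma DERIV_rat_poly_eval:
  "((\<lambda>x::real. rat_poly_eval p x) has_real_derivative rat_poly_eval (pderiv p) x) (at x)"
proof -
  have "map_poly of_rat (pderiv p) = pderiv (map_poly of_rat p :: real poly)"
    by (rule poly_eqI) (simp add: coeff_pderiv coeff_map_poly of_rat_mult of_rat_add)
  then show ?thesis unfolding rat_poly_eval_def by (auto intro: poly_DERIV)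
qed

text \<open>Differentiate \<open>q_poly_eval_cos\<close>: at a root the term containing q(b) drops
  out, and cos (N t / 2) = 0 makes the remaining sine 1 or -1. Squaring removes the sign and leaves
  an expression in \<open>b\<close> alone, by 4 - b^2 = 4 sin^2 t and 2 + b = 4 cos^2 (t /
  2).\<close>

lemma pderiv_q_poly_at_root:
  fixes t :: real
  defines "b \<equiv> 2 * cos t"
  assumes "rat_poly_eval (q_poly n) b = 0"
  shows "(rat_poly_eval (pderiv (q_poly n)) b)\<^sup>2 * ((4 - b\<^sup>2) * (2 + b)) = (real (2 * n + 1))\<^sup>2"
proof -
  define N where "N = real (2 * n + 1)"
  define q' where "q' = rat_poly_eval (pderiv (q_poly n)) b"
  have "((\<lambda>t. rat_poly_eval (q_poly n) (2 * cos t) * cos (t / 2)) has_real_derivative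
      q' * (2 * - sin t) * cos (t / 2) + (- sin (t / 2) * (1 / 2)) * rat_poly_eval (q_poly n) b) (at t)"
    unfolding b_def q'_def
    by (rule DERIV_mult DERIV_chain2[OF DERIV_rat_poly_eval] derivative_eq_intros refl | simp)+
  then have "((\<lambda>t. cos (N * t / 2)) has_real_derivative q' * (2 * - sin t) * cos (t / 2)) (at t)"
    unfolding q_poly_eval_cos N_def using assms(2) by simp
  moreover have "((\<lambda>t. cos (N * t / 2)) has_real_derivative - sin (N * t / 2) * (N / 2)) (at t)"
    by (auto intro!: derivative_eq_intros)
  ultimately have eq: "q' * (2 * - sin t) * cos (t / 2) = - sin (N * t / 2) * (N / 2)"
    by (rule DERIV_unique)
  have "cos (N * t / 2) = 0"
    using q_poly_eval_cos[of n t] assms(2) by (simp add: N_def b_def)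
  then have s: "(sin (N * t / 2))\<^sup>2 = 1" by (simp add: sin_squared_eq)
  have "4 - b\<^sup>2 = 4 * (sin t)\<^sup>2" by (simp add: b_def sin_squared_eq power_mult_distrib)
  moreover have "2 + b = 4 * (cos (t / 2))\<^sup>2"
    using cos_double_cos[of "t / 2"] by (simp add: b_def)
  ultimately have "q'\<^sup>2 * ((4 - b\<^sup>2) * (2 + b)) = 4 * (q' * (2 * - sin t) * cos (t / 2))\<^sup>2"
    by (simp add: power_mult_distrib)
  also have "\<dots> = N\<^sup>2" unfolding eq by (simp add: power_mult_distrib s power_divide)
  finally show ?thesis by (simp add: N_def q'_def)
qed

subsection \<open>Congruences in the ring generated by a real number\<close>

text \<open>The subring Z[a] of the reals, kept as a plain set so that the generator can be any real
  number.\<close>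

definition int_adj :: "real \<Rightarrow> real set" where
  "int_adj a = range (\<lambda>h. rat_poly_eval (rat_of_int_poly h) a)"

lemma int_adj_I: "rat_poly_eval (rat_of_int_poly h) a \<in> int_adj a"
  by (simp add: int_adj_def)

lemma int_adj_of_int: "of_int c \<in> int_adj a"
  using int_adj_I[of "[:c:]" a] by simp

lemma int_adj_numeral: "numeral k \<in> int_adj a"
  using int_adj_of_int[of "numeral k" a] by simp

lemma int_adj_of_nat: "of_nat c \<in> int_adj a"
  using int_adj_of_int[of "int c" a] by simp

lemma int_adj_0: "0 \<in> int_adj a" and int_adj_1: "1 \<in> int_adj a"
  using int_adj_of_int[of 0 a] int_adj_of_int[of 1 a] by simp_all

lemma int_adj_generator: "a \<in> int_adj a"
  using int_adj_I[of "[:0, 1:]" a] by simp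

lemma int_adj_add: "x \<in> int_adj a \<Longrightarrow> y \<in> int_adj a \<Longrightarrow> x + y \<in> int_adj a"
  and int_adj_diff: "x \<in> int_adj a \<Longrightarrow> y \<in> int_adj a \<Longrightarrow> x - y \<in> int_adj a"
  and int_adj_mult: "x \<in> int_adj a \<Longrightarrow> y \<in> int_adj a \<Longrightarrow> x * y \<in> int_adj a"
  unfolding int_adj_def
  by (auto simp flip: rat_poly_eval_add rat_poly_eval_diff rat_poly_eval_mult
        rat_of_int_poly_add rat_of_int_poly_diff rat_of_int_poly_mult)

lemma int_adj_power: "x \<in> int_adj a \<Longrightarrow> x ^ k \<in> int_adj a"
  by (induction k) (auto intro: int_adj_1 int_adj_mult)

lemma int_adj_sum: "(\<And>i. i \<in> A \<Longrightarrow> f i \<in> int_adj a) \<Longrightarrow> sum f A \<in> int_adj a"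
  by (induction A rule: infinite_finite_induct) (auto intro: int_adj_0 int_adj_add)

lemmas int_adj_intros = int_adj_of_int int_adj_of_nat int_adj_numeral int_adj_0 int_adj_1 int_adj_generator
  int_adj_add int_adj_diff int_adj_mult int_adj_power int_adj_sum

lemma int_adj_trans:
  assumes "x \<in> int_adj b" "b \<in> int_adj a"
  shows "x \<in> int_adj a"
proof -
  obtain h where "x = rat_poly_eval (rat_of_int_poly h) b" using assms(1) by (auto simp: int_adj_def)
  moreover have "rat_poly_eval (rat_of_int_poly h) b \<in> int_adj a"
    by (induction h) (auto intro!: int_adj_intros assms(2))
  ultimately show ?thesis by simp
qed

lemma two_cos_int_adj: "2 * cos (real k * t) \<in> int_adj (2 * cos t)"
proof (induction k rule: induct_nat_012)
  case (ge2 k)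
  have "2 * cos (real (Suc (Suc k)) * t) =
      2 * cos t * (2 * cos (real (Suc k) * t)) - 2 * cos (real k * t)"
    using cos_add[of "real (Suc k) * t" t] cos_diff[of "real (Suc k) * t" t]
    by (simp add: algebra_simps)
  then show ?case by (simp only:) (intro int_adj_intros ge2)
qed (auto intro: int_adj_intros)

section \<open>Congruence modulo p Z[a] and the Frobenius map\<close>

definition int_adj_cong :: "nat \<Rightarrow> real \<Rightarrow> real \<Rightarrow> real \<Rightarrow> bool" where
  "int_adj_cong p a x y \<longleftrightarrow> (\<exists>r\<in>int_adj a. x - y = real p * r)"

lemma int_adj_cong_refl: "int_adj_cong p a x x"
  unfolding int_adj_cong_def by (rule bexI[of _ 0]) (auto intro: int_adj_0)

lemma int_adj_cong_sym: "int_adj_cong p a x y \<Longrightarrow> int_adj_cong p a y x"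
proof -
  assume "int_adj_cong p a x y"
  then obtain r where "r \<in> int_adj a" "x - y = real p * r" by (auto simp: int_adj_cong_def)
  then have "0 - r \<in> int_adj a" "y - x = real p * (0 - r)"
    by (auto intro: int_adj_diff int_adj_0 simp: algebra_simps simp del: diff_0)
  then show ?thesis unfolding int_adj_cong_def by blast
qed

lemma int_adj_cong_add:
  assumes "int_adj_cong p a x y" "int_adj_cong p a u v"
  shows "int_adj_cong p a (x + u) (y + v)"
proof -
  obtain r s where "r \<in> int_adj a" "x - y = real p * r" "s \<in> int_adj a" "u - v = real p * s"
    using assms by (auto simp: int_adj_cong_def)
  then have "r + s \<in> int_adj a" "(x + u) - (y + v) = real p * (r + s)"
    by (auto intro: int_adj_add simp: algebra_simps)
  then show ?thesis unfolding int_adj_cong_def by blast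
qed

lemma int_adj_cong_trans [trans]:
  assumes "int_adj_cong p a x y" "int_adj_cong p a y z"
  shows "int_adj_cong p a x z"
proof -
  obtain r s where "r \<in> int_adj a" "x - y = real p * r" "s \<in> int_adj a" "y - z = real p * s"
    using assms by (auto simp: int_adj_cong_def)
  then have "r + s \<in> int_adj a" "x - z = real p * (r + s)"
    by (auto intro: int_adj_add simp: algebra_simps)
  then show ?thesis unfolding int_adj_cong_def by blast
qed

lemma int_adj_cong_mult_left:
  assumes "int_adj_cong p a x y" "c \<in> int_adj a"
  shows "int_adj_cong p a (c * x) (c * y)"
proof -
  obtain r where "r \<in> int_adj a" "x - y = real p * r" using assms by (auto simp: int_adj_cong_def)
  then have "c * r \<in> int_adj a" "c * x - c * y = real p * (c * r)"
    using assms(2) by (auto intro: int_adj_mult simp flip: right_diff_distrib)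
  then show ?thesis unfolding int_adj_cong_def by blast
qed

text \<open>A congruence only asks that a difference lie in p Z[a], so multipliers must be shown to
  lie in Z[a]. The factors are exchanged one at a time, with first \<open>u\<close> and then
  \<open>y\<close> acting as the multiplier.\<close>

lemma int_adj_cong_mult:
  assumes "int_adj_cong p a x y" "int_adj_cong p a u v" "u \<in> int_adj a" "y \<in> int_adj a"
  shows "int_adj_cong p a (x * u) (y * v)"
proof -
  have "int_adj_cong p a (x * u) (y * u)"
    using int_adj_cong_mult_left[OF assms(1,3)] by (simp add: mult.commute)
  also have "int_adj_cong p a (y * u) (y * v)"
    by (rule int_adj_cong_mult_left[OF assms(2,4)])
  finally show ?thesis .
qed

text \<open>The inner binomial coefficients are divisible by the prime \<open>p\<close>. The terms
  \<open>f i\<close> are left general to cover both (x + y)^p and the cosine expansion of (2 cos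
  t)^p.\<close>

lemma int_adj_cong_binomial_sum:
  assumes "prime p" "\<And>i. i \<le> p \<Longrightarrow> f i \<in> int_adj a"
  shows "int_adj_cong p a (\<Sum>i\<le>p. real (p choose i) * f i) (f 0 + f p)"
proof -
  have "{..p} = {0, p} \<union> {0<..<p}" by auto
  then have "(\<Sum>i\<le>p. real (p choose i) * f i) =
      (\<Sum>i\<in>{0, p}. real (p choose i) * f i) + (\<Sum>i\<in>{0<..<p}. real (p choose i) * f i)"
    by (metis (no_types, lifting) finite.emptyI finite.insertI finite_greaterThanLessThan
        sum.union_disjoint disjoint_insert(2) greaterThanLessThan_iff inf_bot_left
        insert_disjoint(1) less_irrefl)
  also have "(\<Sum>i\<in>{0, p}. real (p choose i) * f i) = f 0 + f p"
    using prime_gt_0_nat[OF assms(1)] by simp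
  also have "(\<Sum>i\<in>{0<..<p}. real (p choose i) * f i) =
      real p * (\<Sum>i\<in>{0<..<p}. real ((p choose i) div p) * f i)"
    unfolding sum_distrib_left
  proof (rule sum.cong[OF refl])
    fix i assume "i \<in> {0<..<p}"
    then have "p dvd (p choose i)" using assms(1) by (intro dvd_choose_prime) auto
    then have "real (p choose i) = real p * real ((p choose i) div p)"
      by (metis dvd_mult_div_cancel of_nat_mult)
    then show "real (p choose i) * f i = real p * (real ((p choose i) div p) * f i)" by simp
  qed
  finally have "(\<Sum>i\<le>p. real (p choose i) * f i) - (f 0 + f p) =
      real p * (\<Sum>i\<in>{0<..<p}. real ((p choose i) div p) * f i)" by simp
  moreover have "(\<Sum>i\<in>{0<..<p}. real ((p choose i) div p) * f i) \<in> int_adj a"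
    by (intro int_adj_sum int_adj_mult int_adj_of_nat assms(2)) auto
  ultimately show ?thesis unfolding int_adj_cong_def by blast
qed

lemma int_adj_cong_freshman:
  assumes "prime p" "x \<in> int_adj a" "y \<in> int_adj a"
  shows "int_adj_cong p a ((x + y) ^ p) (x ^ p + y ^ p)"
proof -
  have "int_adj_cong p a (\<Sum>i\<le>p. real (p choose i) * (x ^ i * y ^ (p - i)))
      (x ^ 0 * y ^ (p - 0) + x ^ p * y ^ (p - p))"
    using assms by (intro int_adj_cong_binomial_sum int_adj_mult int_adj_power)
  then show ?thesis by (simp add: binomial_ring mult.assoc add.commute)
qed

lemma int_adj_cong_fermat:
  assumes "prime p"
  shows "int_adj_cong p a (real n ^ p) (real n)"
proof (induction n)
  case 0
  then show ?case using prime_gt_0_nat[OF assms] by (simp add: int_adj_cong_refl zero_power)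
next
  case (Suc n)
  have "int_adj_cong p a ((real n + 1) ^ p) (real n ^ p + 1 ^ p)"
    by (intro int_adj_cong_freshman assms int_adj_intros)
  also have "int_adj_cong p a (real n ^ p + 1 ^ p) (real n + 1)"
    using Suc by (intro int_adj_cong_add) (auto intro: int_adj_cong_refl)
  finally show ?case by (simp add: add.commute)
qed

lemma int_adj_cong_fermat_int:
  assumes "prime p"
  shows "int_adj_cong p a (of_int c ^ p) (of_int c)"
proof -
  \<comment> \<open>Passing to the nonnegative residue reduces a possibly negative \<open>c\<close>
    to the case of natural numbers.\<close>
  define m where "m = nat (c mod int p)"
  have "c mod int p \<ge> 0" using prime_gt_0_nat[OF assms] by simp
  then have "c = int m + int p * (c div int p)" by (simp add: m_def)
  then have "real_of_int c = real m + real p * real_of_int (c div int p)"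
    by (metis of_int_add of_int_mult of_int_of_nat_eq)
  then have cm: "int_adj_cong p a (of_int c) (real m)"
    unfolding int_adj_cong_def by (intro bexI[of _ "of_int (c div int p)"] int_adj_of_int) simp
  have "int_adj_cong p a (of_int c ^ k) (real m ^ k)" for k
    by (induction k) (auto intro!: int_adj_cong_mult int_adj_cong_refl int_adj_intros cm)
  then have "int_adj_cong p a (of_int c ^ p) (real m ^ p)" .
  also have "int_adj_cong p a (real m ^ p) (real m)" by (rule int_adj_cong_fermat[OF assms])
  also have "int_adj_cong p a (real m) (of_int c)" by (rule int_adj_cong_sym[OF cm])
  finally show ?thesis .
qed

text \<open>Horner induction: modulo \<open>p\<close>, raising to the power \<open>p\<close> is
  additive and multiplicative and fixes the integer coefficients, so it carries h(a) to h(a^p),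
  which is congruent to h(b).\<close>

lemma int_adj_cong_poly_frobenius:
  assumes "prime p" "b \<in> int_adj a" "int_adj_cong p a b (a ^ p)"
  shows "int_adj_cong p a (rat_poly_eval (rat_of_int_poly h) b) (rat_poly_eval (rat_of_int_poly h) a ^ p)"
proof (induction h)
  case 0
  then show ?case using prime_gt_0_nat[OF assms(1)] by (simp add: int_adj_cong_refl zero_power)
next
  case (pCons c h)
  let ?e = "\<lambda>x. rat_poly_eval (rat_of_int_poly h) x :: real"
  have "int_adj_cong p a (of_int c + b * ?e b) (of_int c ^ p + a ^ p * ?e a ^ p)"
    using pCons assms(3) int_adj_trans[OF int_adj_I assms(2)]
    by (intro int_adj_cong_add int_adj_cong_mult int_adj_cong_sym[OF int_adj_cong_fermat_int]
        assms(1) int_adj_intros)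
  also have "int_adj_cong p a (of_int c ^ p + a ^ p * ?e a ^ p) ((of_int c + a * ?e a) ^ p)"
    unfolding power_mult_distrib[symmetric]
    by (intro int_adj_cong_sym[OF int_adj_cong_freshman] assms(1) int_adj_intros int_adj_I)
  finally show ?case by simp
qed

text \<open>Real part of the binomial expansion of (e^(-it) + e^(it))^p.\<close>

lemma two_cos_power:
  "(2 * cos t) ^ p = (\<Sum>i\<le>p. real (p choose i) * cos ((real p - 2 * real i) * t))"
proof -
  have "complex_of_real (2 * cos t) = cis (- t) + cis t" by (simp add: complex_eq_iff)
  then have "complex_of_real ((2 * cos t) ^ p) = (cis (- t) + cis t) ^ p" by (metis of_real_power)
  also have "\<dots> = (\<Sum>i\<le>p. of_nat (p choose i) * cis (- t) ^ i * cis t ^ (p - i))"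
    by (rule binomial_ring)
  also have "\<dots> = (\<Sum>i\<le>p. of_real (real (p choose i)) * cis ((real p - 2 * real i) * t))"
  proof (rule sum.cong[OF refl])
    fix i assume "i \<in> {..p}"
    then have "real i * (- t) + real (p - i) * t = (real p - 2 * real i) * t"
      by (simp add: of_nat_diff algebra_simps)
    then show "of_nat (p choose i) * cis (- t) ^ i * cis t ^ (p - i) =
        of_real (real (p choose i)) * cis ((real p - 2 * real i) * t)"
      by (simp add: DeMoivre cis_mult mult.assoc)
  qed
  finally have "Re (complex_of_real ((2 * cos t) ^ p)) =
      Re (\<Sum>i\<le>p. of_real (real (p choose i)) * cis ((real p - 2 * real i) * t))"
    by (rule arg_cong)
  then show ?thesis unfolding Re_complex_of_real Re_sum by simp
qed

text \<open>Modulo \<open>p\<close> only the two outer terms of the expansion survive, and both give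
  cos (p t). Membership in Z[2 cos t] is available for doubled cosines, so the congruence is proved
  for twice the power first and the 2 is then cancelled.\<close>

lemma two_cos_cong_power:
  assumes "prime p" "odd p"
  shows "int_adj_cong p (2 * cos t) (2 * cos (real p * t)) ((2 * cos t) ^ p)"
proof -
  let ?a = "2 * cos t" and ?b = "2 * cos (real p * t)"
  define f where "f = (\<lambda>i. 2 * cos ((real p - 2 * real i) * t))"
  have f: "f i \<in> int_adj ?a" for i
  proof -
    \<comment> \<open>The multiple p - 2i may be negative; as cosine is even, its absolute value
      serves.\<close>
    have "\<exists>k. \<bar>real p - 2 * real i\<bar> = real k"
      by (rule exI[of _ "nat \<bar>int p - 2 * int i\<bar>"]) simp
    then obtain k where k: "\<bar>real p - 2 * real i\<bar> = real k" ..
    have "cos ((real p - 2 * real i) * t) = cos (real k * t)"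
      unfolding k[symmetric] by (simp add: abs_if) (metis cos_minus minus_diff_eq mult_minus_left)
    then show ?thesis by (simp add: f_def two_cos_int_adj)
  qed
  have "2 * ?a ^ p = (\<Sum>i\<le>p. real (p choose i) * f i)"
    unfolding two_cos_power f_def sum_distrib_left by (intro sum.cong) auto
  moreover have "f 0 + f p = 2 * ?b" by (simp add: f_def)
  ultimately have "int_adj_cong p ?a (2 * ?a ^ p) (2 * ?b)"
    using int_adj_cong_binomial_sum[of p f, OF assms(1) f] by simp
  then obtain r where r: "r \<in> int_adj ?a" "2 * ?a ^ p - 2 * ?b = real p * r"
    by (auto simp: int_adj_cong_def)
  obtain k where k: "p = 2 * k + 1" using assms(2) by (elim oddE)
  \<comment> \<open>2 is invertible modulo the odd prime \<open>p\<close>: \<open>u = p * u - k * (2 * u)\<close> for \<open>p = 2 * k + 1\<close>.\<close>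
  have "?b - ?a ^ p = real p * (?b - ?a ^ p) + real k * (2 * ?a ^ p - 2 * ?b)"
    unfolding k by (simp add: algebra_simps)
  also have "\<dots> = real p * (?b - ?a ^ p + real k * r)"
    unfolding r(2) by (simp add: algebra_simps)
  finally have "?b - ?a ^ p = real p * (?b - ?a ^ p + real k * r)" .
  moreover have "?b - ?a ^ p + real k * r \<in> int_adj ?a"
    by (intro int_adj_add int_adj_diff int_adj_mult int_adj_power int_adj_generator int_adj_of_nat
        two_cos_int_adj r(1))
  ultimately show ?thesis unfolding int_adj_cong_def by blast
qed

section \<open>Reduced representatives and rational integers in Z[a]\<close>

lemma int_adj_reduced:
  assumes "rat_poly_eval (rat_of_int_poly F) a = 0" "lead_coeff F = 1" "x \<in> int_adj a" "degree F > 0"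
  obtains h where "x = rat_poly_eval (rat_of_int_poly h) a" "degree h < degree F"
proof -
  obtain g where "x = rat_poly_eval (rat_of_int_poly g) a" using assms(3) by (auto simp: int_adj_def)
  moreover have "\<exists>h. rat_poly_eval (rat_of_int_poly g) a = rat_poly_eval (rat_of_int_poly h) a
      \<and> degree h < degree F"
  proof (induction g)
    case 0
    show ?case using assms(4) by (intro exI[of _ 0]) simp
  next
    case (pCons c g)
    then obtain h where h: "rat_poly_eval (rat_of_int_poly g) a = rat_poly_eval (rat_of_int_poly h) a"
      "degree h < degree F" by blast
    \<comment> \<open>A Horner step reaches at most the degree of \<open>F\<close>. Since
      \<open>F\<close> is monic, an integer multiple of it cancels the coefficient in that degree,
      and its value at \<open>a\<close> is 0.\<close>
    define h' where "h' = pCons c h - smult (coeff (pCons c h) (degree F)) F"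
    have "degree (pCons c h) \<le> degree F" using h(2) by (auto intro: order_trans[OF degree_pCons_le])
    then have "degree h' \<le> degree F"
      unfolding h'_def by (intro degree_diff_le order_trans[OF degree_smult_le]) auto
    moreover have "coeff h' (degree F) = 0" unfolding h'_def using assms(2) by simp
    ultimately have "degree h' < degree F"
      using assms(4) by (metis degree_0 leading_coeff_0_iff le_neq_implies_less)
    moreover have "rat_poly_eval (rat_of_int_poly (pCons c g)) a = rat_poly_eval (rat_of_int_poly h') a"
      unfolding h'_def rat_of_int_poly_diff rat_of_int_poly_smult using h(1) assms(1) by simp
    ultimately show ?case by blast
  qed
  ultimately show ?thesis using that by auto
qed

text \<open>An integer in p Z[a] lies in p Z: writing c = p h(a) with \<open>h\<close> reduced, c -
  p h vanishes at \<open>a\<close> in a degree below that of the minimal polynomial, so it is the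
  zero polynomial, and its constant coefficient gives the divisibility.\<close>

lemma int_adj_cong_0_dvd:
  assumes "is_min_poly_rat (rat_of_int_poly F) a" "int_adj_cong p a (of_int c) 0"
  shows "int p dvd c"
proof -
  have F: "rat_poly_eval (rat_of_int_poly F) a = 0" "lead_coeff F = 1" "degree F > 0"
    using assms(1) min_poly_rat_degree_pos[OF assms(1)] by (auto simp: is_min_poly_rat_def)
  obtain r where r: "r \<in> int_adj a" "of_int c = real p * r"
    using assms(2) by (auto simp: int_adj_cong_def)
  obtain h where h: "r = rat_poly_eval (rat_of_int_poly h) a" "degree h < degree F"
    using F r by (metis int_adj_reduced)
  define g where "g = [:c:] - smult (int p) h"
  have "degree g < degree F"
    unfolding g_def using h(2) F(3) by (intro degree_diff_less) (auto intro: le_less_trans[OF degree_smult_le])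
  moreover have "rat_poly_eval (rat_of_int_poly g) a = 0"
    unfolding g_def rat_of_int_poly_diff rat_of_int_poly_smult using h(1) r(2) by simp
  ultimately have "rat_of_int_poly g = 0"
    using assms(1) unfolding is_min_poly_rat_def by (metis degree_rat_of_int_poly not_le)
  then have "coeff g 0 = 0" by (metis coeff_0 coeff_rat_of_int_poly of_int_eq_0_iff)
  then show ?thesis by (simp add: g_def)
qed

subsection \<open>The conjugates of \<open>2 cos (\<pi> / d)\<close>\<close>

lemma min_poly_rat_cos_prime_multiple:
  assumes f: "is_min_poly_rat f (2 * cos t)" and q: "rat_poly_eval (q_poly n) (2 * cos t) = 0"
    and qb: "rat_poly_eval (q_poly n) (2 * cos (real p * t)) = 0"
    and p: "prime p" "odd p" "\<not> p dvd 2 * n + 1"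
  shows "rat_poly_eval f (2 * cos (real p * t)) = 0"
proof (rule ccontr)
  define a where "a = 2 * cos t"
  define b where "b = 2 * cos (real p * t)"
  define q' where "q' = rat_poly_eval (pderiv (q_poly n)) b"
  assume nz: "rat_poly_eval f (2 * cos (real p * t)) \<noteq> 0"
  obtain s where s: "q_poly n = f * s" using min_poly_rat_dvd[OF f q] by blast
  have lf: "lead_coeff f = 1" using f by (simp add: is_min_poly_rat_def)
  then have ls: "lead_coeff s = 1" using lead_coeff_q_poly[of n] s by (metis lead_coeff_mult mult_1)
  obtain Q where "q_poly n = rat_of_int_poly Q" using q_poly_integral by blast
  with s lf ls obtain F S where F: "f = rat_of_int_poly F" and S: "s = rat_of_int_poly S"
    by (metis monic_rat_factors_integral)
  have b: "b \<in> int_adj a" unfolding a_def b_def by (rule two_cos_int_adj)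
  have "int_adj_cong p a (rat_poly_eval f b) (rat_poly_eval f a ^ p)"
    unfolding F a_def b_def
    by (intro int_adj_cong_poly_frobenius two_cos_cong_power two_cos_int_adj p)
  then have fb: "int_adj_cong p a (rat_poly_eval f b) 0"
    using f prime_gt_0_nat[OF p(1)] by (simp add: is_min_poly_rat_def a_def zero_power)
  have "rat_poly_eval s b = 0" using qb nz by (simp add: s b_def)
  then have q': "q' = rat_poly_eval (pderiv s) b * rat_poly_eval f b"
    by (simp add: q'_def s pderiv_mult)
  have s': "rat_poly_eval (pderiv s) b \<in> int_adj a"
    unfolding S pderiv_rat_of_int_poly by (rule int_adj_trans[OF int_adj_I b])
  have "rat_poly_eval f b \<in> int_adj a" unfolding F by (rule int_adj_trans[OF int_adj_I b])
  \<comment> \<open>The multiplier of f(b) == 0 is chosen so that, with q'(b) = s'(b) f(b), the left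
    side becomes the expression q'(b)^2 (4 - b^2) (2 + b) of
    \<open>pderiv_q_poly_at_root\<close>.\<close>
  then have "int_adj_cong p a
      (q' * rat_poly_eval (pderiv s) b * ((4 - b\<^sup>2) * (2 + b)) * rat_poly_eval f b)
      (q' * rat_poly_eval (pderiv s) b * ((4 - b\<^sup>2) * (2 + b)) * 0)"
    unfolding q' by (intro int_adj_cong_mult_left fb int_adj_intros s' b)
  also have "q' * rat_poly_eval (pderiv s) b * ((4 - b\<^sup>2) * (2 + b)) * rat_poly_eval f b =
      q'\<^sup>2 * ((4 - b\<^sup>2) * (2 + b))"
    by (simp add: q' power2_eq_square mult_ac)
  also have "\<dots> = of_int (int ((2 * n + 1)\<^sup>2))"
    using pderiv_q_poly_at_root[of n "real p * t"] qb by (simp add: q'_def b_def)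
  finally have "int_adj_cong p a (of_int (int ((2 * n + 1)\<^sup>2))) 0" by simp
  then have "int p dvd int ((2 * n + 1)\<^sup>2)"
    using f F int_adj_cong_0_dvd unfolding a_def by blast
  then have "p dvd (2 * n + 1)\<^sup>2" by (simp only: int_dvd_int_iff)
  with p show False using prime_dvd_power_nat by blast
qed

text \<open>With 2n + 1 = d k, both \<open>k\<close> and \<open>m\<close> are odd, so (2n + 1) t / 2
  is an odd multiple of pi / 2. As \<open>d\<close> does not divide \<open>m\<close>, cos (t / 2) is
  nonzero and cancels from \<open>q_poly_eval_cos\<close>.\<close>

lemma q_poly_root:
  assumes "odd m" "d dvd 2 * n + 1" "\<not> d dvd m"
  shows "rat_poly_eval (q_poly n) (2 * cos (real m * pi / real d)) = 0"
proof -
  define t where "t = real m * pi / real d"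
  obtain k where k: "2 * n + 1 = d * k" using assms(2) by blast
  have "odd (2 * n + 1)" by simp
  then have "odd (d * k)" unfolding k .
  then have "odd k" "d > 0" by (simp, metis even_zero mult_0 not_gr_zero)
  have "real (2 * n + 1) * t / 2 = of_int (int (k * m)) * (pi / 2)"
    unfolding k t_def using \<open>d > 0\<close> by simp
  moreover have "odd (int (k * m))" using \<open>odd k\<close> assms(1) by simp
  ultimately have "cos (real (2 * n + 1) * t / 2) = 0" unfolding cos_zero_iff_int by blast
  moreover have "cos (t / 2) \<noteq> 0"
  proof
    assume "cos (t / 2) = 0"
    then obtain i where i: "t / 2 = of_int i * (pi / 2)" unfolding cos_zero_iff_int by blast
    then have "real m = of_int i * real d" unfolding t_def using \<open>d > 0\<close> by (simp add: field_simps)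
    then have "int m = i * int d" by (metis of_int_eq_iff of_int_mult of_int_of_nat_eq)
    then show False using assms(3) by (metis dvd_triv_right int_dvd_int_iff)
  qed
  ultimately show ?thesis using q_poly_eval_cos[of n t] by (simp add: t_def)
qed

text \<open>Strong induction on \<open>m\<close>, splitting off a prime: for m = p j the polynomial
  already vanishes at 2 cos (j pi / d), hence is the minimal polynomial there too, and the angle can
  be multiplied by \<open>p\<close>.\<close>

lemma C_poly_root:
  assumes "odd d" "d > 1" "odd m" "coprime m d"
  shows "rat_poly_eval (C_poly d) (2 * cos (real m * pi / real d)) = 0"
  using assms(3,4)
proof (induction m rule: less_induct)
  case (less m)
  \<comment> \<open>The auxiliary \<open>q_poly n\<close> is the one attached to \<open>d\<close>
    itself, so coprimality of \<open>p\<close> and \<open>d\<close> is exactly what keeps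
    \<open>p\<close> from dividing 2n + 1.\<close>
  obtain n where n: "d = 2 * n + 1" using assms(1) by (elim oddE)
  have C: "is_min_poly_rat (C_poly d) (2 * cos (pi / real d))" using C_poly assms(2) by simp
  show ?case
  proof (cases "m = 1")
    case True
    then show ?thesis using C by (simp add: is_min_poly_rat_def)
  next
    case False
    then obtain p where p: "prime p" "p dvd m" using prime_factor_nat by blast
    then obtain j where m: "m = p * j" by blast
    have "m > 0" using less(2) by (rule odd_pos)
    then have "j < m" using m prime_gt_1_nat[OF p(1)] by auto
    have odd: "odd p" "odd j" using less(2) m by auto
    have cop: "coprime p d" "coprime j d" using less(3) m by auto
    have nd: "\<not> d dvd x" if "coprime x d" for x
      using coprime_common_divisor[OF that, of d] assms(2) by auto
    let ?t = "real j * pi / real d"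
    have mt: "real m * pi / real d = real p * ?t" by (simp add: m)
    have min: "is_min_poly_rat (C_poly d) (2 * cos ?t)"
      using C less(1)[OF \<open>j < m\<close> odd(2) cop(2)] by (rule min_poly_rat_conjugate)
    have root: "rat_poly_eval (q_poly n) (2 * cos ?t) = 0"
      by (rule q_poly_root[OF odd(2) _ nd[OF cop(2)]]) (simp add: n)
    have root': "rat_poly_eval (q_poly n) (2 * cos (real p * ?t)) = 0"
      unfolding mt[symmetric] by (rule q_poly_root[OF less(2) _ nd[OF less(3)]]) (simp add: n)
    have "\<not> p dvd d"
      using coprime_common_divisor[OF cop(1) dvd_refl] not_prime_unit p(1) by blast
    then have "\<not> p dvd 2 * n + 1" unfolding n .
    with min root root' p(1) odd(1) show ?thesis
      unfolding mt by (rule min_poly_rat_cos_prime_multiple)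
  qed
qed

text \<open>\<open>C_poly d\<close> divides \<open>q_poly n\<close> for d = 2n + 1. At t = pi / e
  the angle d t / 2 stays strictly between 0 and pi / 2, so \<open>q_poly_eval_cos\<close> shows
  that this multiple is nonzero.\<close>

lemma C_poly_nonroot_less:
  assumes "odd d" "1 < d" "d < e"
  shows "rat_poly_eval (C_poly d) (2 * cos (pi / real e)) \<noteq> 0"
proof
  assume root: "rat_poly_eval (C_poly d) (2 * cos (pi / real e)) = 0"
  obtain n where n: "d = 2 * n + 1" using assms(1) by (elim oddE)
  have "is_min_poly_rat (C_poly d) (2 * cos (pi / real d))" using C_poly assms(2) by simp
  moreover have "rat_poly_eval (q_poly n) (2 * cos (pi / real d)) = 0"
    using q_poly_root[of 1 d n] assms(2) by (simp add: n)
  ultimately have "C_poly d dvd q_poly n" by (rule min_poly_rat_dvd)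
  then have "rat_poly_eval (q_poly n) (2 * cos (pi / real e)) = 0" using root by (auto elim!: dvdE)
  then have "cos (real d * (pi / real e) / 2) = 0"
    using q_poly_eval_cos[of n "pi / real e"] by (simp add: n)
  moreover have "cos (real d * (pi / real e) / 2) > 0"
  proof (rule cos_gt_zero)
    show "0 < real d * (pi / real e) / 2" using assms by simp
    have "real d / real e < 1" using assms by simp
    then have "real d / real e * (pi / 2) < 1 * (pi / 2)" by (intro mult_strict_right_mono) auto
    then show "real d * (pi / real e) / 2 < pi / 2" by simp
  qed
  ultimately show False by simp
qed

text \<open>For d > e a common root would make the two minimal polynomials equal, so
  \<open>C_poly e\<close> would vanish at 2 cos (pi / d), which is the previous case with the roles
  exchanged.\<close>

lemma C_poly_nonroot:
  assumes "odd d" "1 < d" "odd e" "1 < e" "d \<noteq> e"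
  shows "rat_poly_eval (C_poly d) (2 * cos (pi / real e)) \<noteq> 0"
proof (cases "d < e")
  case False
  have C: "is_min_poly_rat (C_poly d) (2 * cos (pi / real d))"
    "is_min_poly_rat (C_poly e) (2 * cos (pi / real e))" using C_poly assms by simp_all
  show ?thesis
  proof
    assume "rat_poly_eval (C_poly d) (2 * cos (pi / real e)) = 0"
    then have "C_poly d = C_poly e"
      using C min_poly_rat_conjugate is_min_poly_rat_unique by blast
    then show False
      using C(1) C_poly_nonroot_less[of e d] assms False by (auto simp: is_min_poly_rat_def)
  qed
qed (use assms C_poly_nonroot_less in simp)

section \<open>Root counting and the product formula\<close>

lemma card_roots_le_degree:
  assumes "p \<noteq> 0" "\<And>x::real. x \<in> A \<Longrightarrow> rat_poly_eval p x = 0"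
  shows "card A \<le> degree p"
proof -
  let ?p = "map_poly of_rat p :: real poly"
  have "?p \<noteq> 0" using assms(1) by (subst map_poly_eq_0_iff) auto
  moreover have "A \<subseteq> {x. poly ?p x = 0}" using assms(2) by (auto simp: rat_poly_eval_def)
  moreover have "degree ?p = degree p" by (rule degree_map_poly) auto
  ultimately show ?thesis
    by (metis card_mono card_poly_roots_bound order_trans poly_roots_finite)
qed

theorem mainTheorem10:
  fixes n :: nat
  assumes "n \<ge> 1"
  shows "q_poly n = (\<Prod>d | 1 < d \<and> d dvd 2 * n + 1. C_poly d)"
proof -
  define D where "D = {d. 1 < d \<and> d dvd 2 * n + 1}"
  define P where "P = (\<Prod>d\<in>D. C_poly d)"
  have fin: "finite D" unfolding D_def by (rule finite_subset[of _ "{..2 * n + 1}"]) (auto dest: dvd_imp_le)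
  have D: "odd d" "1 < d" "d dvd 2 * n + 1" if "d \<in> D" for d
    using that dvd_trans[of 2 d "2 * n + 1"] by (auto simp: D_def)
  have C: "is_min_poly_rat (C_poly d) (2 * cos (pi / real d))" if "d \<in> D" for d
    using C_poly D[OF that] by simp
  have "P dvd q_poly n"
    unfolding P_def
  proof (rule prod_min_poly_rat_dvd[OF fin C])
    show "rat_poly_eval (q_poly n) (2 * cos (pi / real d)) = 0" if "d \<in> D" for d
      using q_poly_root[of 1 d n] D[OF that] by simp
    show "rat_poly_eval (C_poly d) (2 * cos (pi / real e)) \<noteq> 0" if "d \<in> D" "e \<in> D" "d \<noteq> e" for d e
      using D that by (intro C_poly_nonroot) auto
  qed
  then obtain s where s: "q_poly n = P * s" by blast
  have "lead_coeff P = (\<Prod>d\<in>D. lead_coeff (C_poly d))" unfolding P_def by (rule lead_coeff_prod)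
  also have "\<dots> = 1" using C by (intro prod.neutral) (auto simp: is_min_poly_rat_def)
  finally have lP: "lead_coeff P = 1" .
  then have ls: "lead_coeff s = 1" using lead_coeff_q_poly[of n] s by (metis lead_coeff_mult mult_1)
  \<comment> \<open>For k < n these are the odd multiples of pi / (2n + 1) strictly below pi; k = n
    would give pi itself. Injectivity of cosine on [0, pi] makes the \<open>x k\<close>
    distinct.\<close>
  define \<theta> where "\<theta> = (\<lambda>k. real (2 * k + 1) * pi / real (2 * n + 1))"
  define x where "x = (\<lambda>k. 2 * cos (\<theta> k))"
  have \<theta>: "0 \<le> \<theta> k" "\<theta> k \<le> pi" if "k < n" for k
  proof -
    have "real (2 * k + 1) * pi \<le> real (2 * n + 1) * pi"
      by (rule mult_right_mono) (use that in auto)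
    then have "real (2 * k + 1) * pi \<le> pi * real (2 * n + 1)" by (simp only: mult.commute)
    then show "\<theta> k \<le> pi" unfolding \<theta>_def by (subst pos_divide_le_eq) simp_all
    show "0 \<le> \<theta> k" by (simp add: \<theta>_def)
  qed
  have "inj_on x {..<n}"
  proof (rule inj_onI)
    fix k l assume kl: "k \<in> {..<n}" "l \<in> {..<n}" "x k = x l"
    then have "cos (\<theta> k) = cos (\<theta> l)" by (simp add: x_def)
    then have "\<theta> k = \<theta> l" using kl \<theta> by (metis cos_inj_pi lessThan_iff)
    then have "real (2 * k + 1) = real (2 * l + 1)"
      unfolding \<theta>_def divide_cancel_right mult_cancel_right by simp
    then show "k = l" by simp
  qed
  then have "n = card (x ` {..<n})" by (simp add: card_image)
  also have "\<dots> \<le> degree P"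
  proof (rule card_roots_le_degree)
    show "P \<noteq> 0" using lP by auto
    fix y assume "y \<in> x ` {..<n}"
    then obtain k where k: "k < n" "y = x k" by auto
    \<comment> \<open>Reducing (2k + 1) / (2n + 1) to lowest terms m / d selects the factor
      \<open>C_poly d\<close> that vanishes at \<open>x k\<close>; m < d guarantees d > 1.\<close>
    define g where "g = gcd (2 * k + 1) (2 * n + 1)"
    obtain m d where md: "2 * k + 1 = m * g" "2 * n + 1 = d * g" "coprime m d"
      using gcd_coprime_exists[of "2 * k + 1" "2 * n + 1"] unfolding g_def by auto
    have "odd (m * g)" "odd (d * g)" unfolding md(1,2)[symmetric] by simp_all
    then have odd: "odd m" "odd d" "odd g" by simp_all
    have "m * g < d * g" using k unfolding md(1,2)[symmetric] by simp
    then have "m < d" by simp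
    with odd_pos[OF odd(1)] have "d > 1" by simp
    then have "d \<in> D" by (simp only: D_def md(2) mem_Collect_eq dvd_triv_left)
    have "y = 2 * cos (real m * pi / real d)"
      unfolding k x_def \<theta>_def md(1,2) using odd_pos[OF odd(3)] by simp
    then have "rat_poly_eval (C_poly d) y = 0"
      using C_poly_root odd \<open>d > 1\<close> md(3) by simp
    moreover have "C_poly d dvd P" unfolding P_def using fin \<open>d \<in> D\<close> by (rule dvd_prodI)
    ultimately show "rat_poly_eval P y = 0" by (auto elim!: dvdE)
  qed
  \<comment> \<open>The \<open>n\<close> distinct roots give \<open>P\<close> at least the degree of
    its multiple \<open>q_poly n\<close>, so the monic cofactor \<open>s\<close> is constant, hence
    1.\<close>
  finally have "degree (q_poly n) \<le> degree P" using lead_coeff_q_poly[of n] by simp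
  moreover have "P \<noteq> 0" "s \<noteq> 0" using lP ls by auto
  ultimately have "degree s = 0" unfolding s by (simp add: degree_mult_eq)
  then obtain c where "s = [:c:]" by (rule degree_eq_zeroE)
  with ls have "s = 1" by (simp add: one_pCons)
  with s show ?thesis by (simp add: P_def D_def)
qed

end
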